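(* Let $n$ be a positive integer and let $\pi_1(\mathcal{G}_2)$ be the group $\langle x,y,z : xyx^{-1}y^{-1}=1,\ zxz^{-1}=x^{-1},\ zyz^{-1}=y^{-1}\rangle$. Every subgroup $\Delta$ of index $n$ in $\pi_1(\mathcal{G}_2)$ is isomorphic to either $\pi_1(\mathcal{G}_2)$ or $\mathbb{Z}^3$. The respective numbers of subgroups are (i) $s_{\pi_1(\mathcal{G}_2),\pi_1(\mathcal{G}_2)}(n)=\omega(n)-\omega\left(\frac{n}{2}\right)$; (ii) $s_{\mathbb{Z}^3,\pi_1(\mathcal{G}_2)}(n)=\omega\left(\frac{n}{2}\right)$.
   Context: For groups $H,G$, $s_{H,G}(n)$ denotes the number of subgroups of index $n$ in $G$ that are isomorphic to $H$. For a positive integer $n$, $\sigma_1(n)=\sum_{k\mid n}k$ and $\omega(n)=\sum_{k\mid n}k\,\sigma_1(k)$ (sums over positive divisors). By convention $\omega(r)=0$ if $r$ is not a positive integer. *)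

theory Defs
  imports Complex_Main "HOL-Algebra.Elementary_Groups"
begin

text \<open>
  Groups given by generators and relations. A word is a list of letters; the letter \<open>(a, True)\<close>
  stands for the generator \<open>a\<close> and \<open>(a, False)\<close> for its formal inverse. A set of relations is a set
  of pairs \<open>(l, r)\<close> of words, to be read as the equations \<open>l = r\<close>. The presented group consists of
  the words modulo the smallest congruence for concatenation that allows free cancellation and
  identifies the two sides of every relation; this is the free group modulo the normal closure of
  the elements \<open>l r\<^sup>-\<^sup>1\<close>.
\<close>

type_synonym 'a word = "('a \<times> bool) list"

inductive word_eq :: "('a word \<times> 'a word) set \<Rightarrow> 'a word \<Rightarrow> 'a word \<Rightarrow> bool" for R where
  refl: "word_eq R u u"
| sym: "word_eq R u v \<Longrightarrow> word_eq R v u"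
| trans: "word_eq R u v \<Longrightarrow> word_eq R v w \<Longrightarrow> word_eq R u w"
| append: "word_eq R u u' \<Longrightarrow> word_eq R v v' \<Longrightarrow> word_eq R (u @ v) (u' @ v')"
| cancel: "word_eq R [(a, b), (a, \<not> b)] []"
| relation: "(l, r) \<in> R \<Longrightarrow> word_eq R l r"

definition word_class :: "('a word \<times> 'a word) set \<Rightarrow> 'a word \<Rightarrow> 'a word set" where
  "word_class R u = {v. word_eq R u v}"

definition presented_group :: "('a word \<times> 'a word) set \<Rightarrow> 'a word set monoid" where
  "presented_group R =
    \<lparr>carrier = range (word_class R),
     mult = (\<lambda>A B. \<Union>u\<in>A. \<Union>v\<in>B. word_class R (u @ v)),
     one = word_class R []\<rparr>"

lemma word_class_eq_iff: "word_class R u = word_class R v \<longleftrightarrow> word_eq R u v"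
proof
  assume "word_class R u = word_class R v"
  moreover have "v \<in> word_class R v"
    by (simp add: word_class_def word_eq.refl)
  ultimately have "v \<in> word_class R u"
    by simp
  then show "word_eq R u v"
    by (simp add: word_class_def)
next
  assume "word_eq R u v"
  then have "word_eq R u w \<longleftrightarrow> word_eq R v w" for w
    using word_eq.sym word_eq.trans by blast
  then show "word_class R u = word_class R v"
    by (simp add: word_class_def)
qed

lemma presented_group_mult:
  "word_class R u \<otimes>\<^bsub>presented_group R\<^esub> word_class R v = word_class R (u @ v)"
proof -
  have "word_class R (u' @ v') = word_class R (u @ v)"
    if "u' \<in> word_class R u" "v' \<in> word_class R v" for u' v'
  proof -
    have "word_eq R (u @ v) (u' @ v')"
      using that by (intro word_eq.append) (simp_all add: word_class_def)
    then show ?thesis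
      by (simp only: word_class_eq_iff) (rule word_eq.sym)
  qed
  moreover have "u \<in> word_class R u" "v \<in> word_class R v"
    by (simp_all add: word_class_def word_eq.refl)
  ultimately have "(\<Union>u'\<in>word_class R u. \<Union>v'\<in>word_class R v. word_class R (u' @ v')) =
      word_class R (u @ v)"
    by blast
  then show ?thesis
    by (simp add: presented_group_def)
qed

lemma word_inverse: "\<exists>v. word_eq R (v @ u) []"
proof (induction u)
  case Nil
  show ?case using word_eq.refl by force
next
  case (Cons p u)
  obtain a b where p: "p = (a, b)" by fastforce
  from Cons obtain v where v: "word_eq R (v @ u) []" by blast
  have "word_eq R ([(a, \<not> b)] @ [(a, b)]) []"
    using word_eq.cancel[of R a "\<not> b"] by simp
  then have "word_eq R ((v @ [(a, \<not> b), (a, b)]) @ u) ((v @ []) @ u)"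
    by (intro word_eq.append word_eq.refl) simp
  then have "word_eq R ((v @ [(a, \<not> b)]) @ p # u) []"
    using word_eq.trans[OF _ v] by (simp add: p)
  then show ?case by blast
qed

lemma group_presented_group: "group (presented_group R)"
proof -
  have carrier: "carrier (presented_group R) = range (word_class R)"
    and one: "\<one>\<^bsub>presented_group R\<^esub> = word_class R []"
    by (simp_all add: presented_group_def)
  have "\<exists>v. word_class R v \<otimes>\<^bsub>presented_group R\<^esub> word_class R u = \<one>\<^bsub>presented_group R\<^esub>" for u
    using word_inverse[of R u] by (simp add: one presented_group_mult word_class_eq_iff)
  then show ?thesis
    by (intro groupI) (auto simp: carrier one presented_group_mult)
qed

datatype gen = X | Y | Z

definition pi1_G2 :: "gen word set monoid" where
  "pi1_G2 =
    (let x = (X, True); x' = (X, False); y = (Y, True); y' = (Y, False);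
         z = (Z, True); z' = (Z, False)
     in presented_group
          {([x, y, x', y'], []), ([z, x, z'], [x']), ([z, y, z'], [y'])})"

definition Z3 :: "(int \<times> int \<times> int) monoid" where
  "Z3 = integer_group \<times>\<times> integer_group \<times>\<times> integer_group"

text \<open>
  As \<open>card\<close> of an infinite set is \<open>0\<close>, these definitions have the usual meaning only for \<open>n > 0\<close>
  (index) and for finite sets of subgroups (\<open>num_subgroups\<close>).
\<close>

definition index_subgroups :: "('a, 'b) monoid_scheme \<Rightarrow> nat \<Rightarrow> 'a set set" where
  "index_subgroups G n = {\<Delta>. subgroup \<Delta> G \<and> card (rcosets\<^bsub>G\<^esub> \<Delta>) = n}"

definition num_subgroups :: "('c, 'd) monoid_scheme \<Rightarrow> ('a, 'b) monoid_scheme \<Rightarrow> nat \<Rightarrow> nat" where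
  "num_subgroups H G n = card {\<Delta> \<in> index_subgroups G n. G\<lparr>carrier := \<Delta>\<rparr> \<cong> H}"

definition sigma1 :: "nat \<Rightarrow> nat" where
  "sigma1 n = (\<Sum>k | k dvd n. k)"

definition omega :: "rat \<Rightarrow> nat" where
  "omega r = (if r \<in> \<int> \<and> r > 0 then \<Sum>k | k dvd nat \<lfloor>r\<rfloor>. k * sigma1 k else 0)"

end

theory Submission
  imports Defs
begin

text \<open>
  The group is a semidirect product of the lattice \<open>\<int>\<^sup>2\<close> spanned by \<open>x\<close> and \<open>y\<close> with the
  infinite cyclic group generated by \<open>z\<close>, which acts by \<open>-1\<close>. So every element has a unique normal
  form \<open>x\<^sup>i y\<^sup>j z\<^sup>k\<close>, and multiplication becomes
  \<open>(v, k) (v', k') = (v + (-1)\<^sup>k v', k + k')\<close> on \<open>\<int>\<^sup>2 \<times> \<int>\<close>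
  (\<open>pi1_G2_iso_twisted_group\<close>).

  A subgroup \<open>\<Delta>\<close> of finite index is determined by three data: the generator \<open>l > 0\<close> of its
  projection to the exponents of \<open>z\<close>, the sublattice \<open>L = \<Delta> \<inter> \<int>\<^sup>2\<close>, and the coset of \<open>L\<close>
  formed by the vectors \<open>v\<close> with \<open>(v, l) \<in> \<Delta>\<close>. Since \<open>-1\<close> preserves every sublattice and every
  coset representative \<open>v\<close> is admissible, these data can be chosen freely, and the index is \<open>l\<close>
  times the index of \<open>L\<close>. With \<open>L\<close> and \<open>v\<close> in Hermite normal form, \<open>\<Delta>\<close> is generated
  by the elements \<open>(a, 0, 0)\<close>, \<open>(s, b, 0)\<close>, \<open>(p, q, l)\<close> for unique integers with
  \<open>0 \<le> s < a\<close>, \<open>0 \<le> p < a\<close>, \<open>0 \<le> q < b\<close>, and its index is \<open>a b l\<close>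
  (\<open>finite_index_subgroup_hermite\<close>, \<open>hermite_form_unique\<close>,
  \<open>range_embed_in_index_subgroups\<close>).

  Put \<open>k = a b\<close>. For a given \<open>k\<close> dividing \<open>n\<close> there are \<open>\<sigma>\<^sub>1(k)\<close> lattices \<open>L\<close> of index \<open>k\<close> and
  \<open>k\<close> cosets of each, and so \<open>k \<sigma>\<^sub>1(k)\<close> subgroups with \<open>l = n / k\<close>. The third generator acts
  on \<open>L\<close> by \<open>(-1)\<^sup>l\<close>. Hence the subgroup is free abelian if \<open>l\<close> is even, and again of
  the original type if \<open>l\<close> is odd (\<open>range_embed_iso\<close>); one of these groups is abelian and the
  other is not. Summing \<open>k \<sigma>\<^sub>1(k)\<close> over the divisors \<open>k\<close> of \<open>n\<close> with \<open>n / k\<close> even is summing over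
  the divisors of \<open>n / 2\<close>, which gives \<open>\<omega>(n/2)\<close>; the remaining divisors give
  \<open>\<omega>(n) - \<omega>(n/2)\<close>.
\<close>

section \<open>Subgroups of finite index\<close>

lemma (in group) card_rcosets_eq_card_transversal:
  assumes H: "subgroup H G" and T: "T \<subseteq> carrier G"
    and unique: "\<And>g. g \<in> carrier G \<Longrightarrow> \<exists>!t. t \<in> T \<and> g \<otimes> inv t \<in> H"
  shows "card (rcosets H) = card T"
proof -
  have same: "g \<in> H #> t \<longleftrightarrow> g \<otimes> inv t \<in> H" if "g \<in> carrier G" "t \<in> carrier G" for g t
    using subgroup.rcos_module[OF H is_group] that by blast
  have "inj_on (\<lambda>t. H #> t) T"
  proof (rule inj_onI)
    fix t u assume tu: "t \<in> T" "u \<in> T" "H #> t = H #> u"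
    then have "t \<in> H #> u" "t \<in> H #> t"
      using rcos_self[OF _ H, of t] T by auto
    then have "t \<otimes> inv u \<in> H" "t \<otimes> inv t \<in> H"
      using same tu T by blast+
    then show "t = u" using unique[of t] tu T by blast
  qed
  moreover have "(\<lambda>t. H #> t) ` T = rcosets H"
  proof
    show "(\<lambda>t. H #> t) ` T \<subseteq> rcosets H"
      using T by (auto simp: RCOSETS_def)
    show "rcosets H \<subseteq> (\<lambda>t. H #> t) ` T"
    proof
      fix C assume "C \<in> rcosets H"
      then obtain g where g: "g \<in> carrier G" "C = H #> g" by (auto simp: RCOSETS_def)
      obtain t where t: "t \<in> T" "g \<otimes> inv t \<in> H" using unique[OF g(1)] by blast
      then have "g \<in> H #> t" using same g T by blast
      then have "H #> t = H #> g" using repr_independence[OF _ _ H] t T by blast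
      then show "C \<in> (\<lambda>t. H #> t) ` T" using t g by blast
    qed
  qed
  ultimately show ?thesis by (metis card_image)
qed

text \<open>
  Two of the elements \<open>h 0, h 1, \<dots>\<close> lie in the same coset, by the pigeonhole
  principle; their quotient is the desired element. Applied to the three coordinate axes, this
  makes the generators \<open>a\<close>, \<open>b\<close>, \<open>l\<close> of the Hermite normal form nonzero.
\<close>

lemma (in group) finite_index_meets_int_hom:
  assumes H: "subgroup H G" and fin: "finite (rcosets H)" and h: "h \<in> hom integer_group G"
  shows "\<exists>k>0. h k \<in> H"
proof -
  interpret h: group_hom integer_group G h
    using h by (simp add: group_hom_def group_hom_axioms_def)
  have hc: "h k \<in> carrier G" for k using h.hom_closed by simp
  have "range (\<lambda>k::nat. H #> h (int k)) \<subseteq> rcosets H"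
    using hc by (fastforce simp: RCOSETS_def)
  then have "finite (range (\<lambda>k::nat. H #> h (int k)))"
    using fin finite_subset by blast
  then have "\<not> inj (\<lambda>k::nat. H #> h (int k))"
    using finite_imageD infinite_UNIV_nat by blast
  then have "\<exists>i j::nat. i < j \<and> H #> h (int i) = H #> h (int j)"
    by (simp add: linorder_inj_onI' inj_on_def) (metis linorder_neqE_nat)
  then obtain i j :: nat where ij: "i < j" "H #> h (int i) = H #> h (int j)"
    by blast
  then have "h (int j) \<in> H #> h (int i)"
    using rcos_self[OF hc H] by blast
  then have "h (int j) \<otimes> inv (h (int i)) \<in> H"
    using subgroup.rcos_module[OF H is_group hc hc] by blast
  moreover have "h (int j) \<otimes> inv (h (int i)) = h (int j - int i)"
    using h.hom_mult[of "int j" "- int i"] h.hom_inv[of "int i"] by simp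
  ultimately show ?thesis using ij by (intro exI[of _ "int j - int i"]) simp
qed

lemma (in group) int_hom_in_subgroup:
  assumes H: "subgroup H G" and h: "h \<in> hom integer_group G" and h1: "h 1 \<in> H"
  shows "h k \<in> H"
proof -
  interpret h: group_hom integer_group G h
    using h by (simp add: group_hom_def group_hom_axioms_def)
  have "h k = h 1 [^] k"
    using h.hom_int_pow[of 1 k] by simp
  then show ?thesis
    using subgroup_int_pow_closed[OF H h1] by simp
qed

text \<open>
  The least positive member generates, because the remainder of a member modulo it is again a
  member.
\<close>

lemma int_diff_closed_principal:
  fixes S :: "int set"
  assumes diff: "\<And>i j. i \<in> S \<Longrightarrow> j \<in> S \<Longrightarrow> i - j \<in> S" and pos: "\<exists>k>0. k \<in> S"
  shows "\<exists>d>0. S = {i. d dvd i}"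
proof -
  define d where "d = (LEAST k::nat. k > 0 \<and> int k \<in> S)"
  have ex: "\<exists>k::nat. k > 0 \<and> int k \<in> S"
  proof -
    obtain k where "k > 0" "k \<in> S" using pos by blast
    then show ?thesis by (intro exI[of _ "nat k"]) simp
  qed
  have d: "d > 0" "int d \<in> S" using LeastI_ex[OF ex] unfolding d_def by auto
  have least: "d \<le> k" if "k > 0" "int k \<in> S" for k
    unfolding d_def using that by (intro Least_le) auto
  have zero: "0 \<in> S" using diff[OF d(2) d(2)] by simp
  have neg: "- i \<in> S" if "i \<in> S" for i using diff[OF zero that] by simp
  have add: "i + j \<in> S" if "i \<in> S" "j \<in> S" for i j using diff[OF that(1) neg[OF that(2)]] by simp
  have mult: "int d * i \<in> S" for i
  proof (induction i rule: int_induct[where k = 0])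
    case base then show ?case using zero by simp
  next
    case (step1 i) then show ?case using add[OF step1(2) d(2)] by (simp add: algebra_simps)
  next
    case (step2 i) then show ?case using diff[OF step2(2) d(2)] by (simp add: algebra_simps)
  qed
  have "int d dvd i" if "i \<in> S" for i
  proof -
    have "i mod int d \<in> S"
      using diff[OF that mult[of "i div int d"]] by (simp add: minus_mult_div_eq_mod)
    moreover have "0 \<le> i mod int d" "i mod int d < int d" using d by simp_all
    ultimately have "i mod int d = 0"
      using least[of "nat (i mod int d)"] by (cases "i mod int d = 0") auto
    then show ?thesis by auto
  qed
  then show ?thesis using mult d by (intro exI[of _ "int d"]) (auto elim!: dvdE)
qed

section \<open>Transport along isomorphisms\<close>

lemma iso_image_index_subgroups:
  assumes G: "group G" and H: "group H" and h: "h \<in> iso G H" and \<Delta>: "\<Delta> \<in> index_subgroups G n"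
  shows "h ` \<Delta> \<in> index_subgroups H n"
proof -
  interpret group_hom G H h
    using G H h by (simp add: group_hom_def group_hom_axioms_def iso_def)
  have sub: "subgroup \<Delta> G" and n: "card (rcosets\<^bsub>G\<^esub> \<Delta>) = n"
    using \<Delta> by (auto simp: index_subgroups_def)
  have bij: "bij_betw h (carrier G) (carrier H)" using h by (simp add: iso_def)
  have coset: "h ` (\<Delta> #>\<^bsub>G\<^esub> g) = (h ` \<Delta>) #>\<^bsub>H\<^esub> h g" if "g \<in> carrier G" for g
    using that subgroup.mem_carrier[OF sub] by (force simp: r_coset_def)
  have "rcosets\<^bsub>H\<^esub> (h ` \<Delta>) = (\<lambda>g. (h ` \<Delta>) #>\<^bsub>H\<^esub> g) ` carrier H"
    by (auto simp: RCOSETS_def)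
  also have "\<dots> = (\<lambda>g. (h ` \<Delta>) #>\<^bsub>H\<^esub> h g) ` carrier G"
    by (simp flip: bij_betw_imp_surj_on[OF bij] add: image_image)
  also have "\<dots> = (\<lambda>g. h ` (\<Delta> #>\<^bsub>G\<^esub> g)) ` carrier G"
    using coset by (intro image_cong) auto
  also have "\<dots> = (`) h ` (rcosets\<^bsub>G\<^esub> \<Delta>)"
    by (auto simp: RCOSETS_def)
  finally have "rcosets\<^bsub>H\<^esub> (h ` \<Delta>) = (`) h ` (rcosets\<^bsub>G\<^esub> \<Delta>)" .
  moreover have "inj_on ((`) h) (rcosets\<^bsub>G\<^esub> \<Delta>)"
  proof (rule inj_on_subset[OF inj_on_image_Pow])
    show "inj_on h (carrier G)" using bij by (simp add: bij_betw_def)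
    show "rcosets\<^bsub>G\<^esub> \<Delta> \<subseteq> Pow (carrier G)"
      using subgroup.rcosets_carrier[OF sub G] by blast
  qed
  ultimately have "card (rcosets\<^bsub>H\<^esub> (h ` \<Delta>)) = n" using n by (simp add: card_image)
  then show ?thesis using subgroup_img_is_subgroup[OF sub] by (simp add: index_subgroups_def)
qed

lemma bij_betw_index_subgroups:
  assumes G: "group G" and H: "group H" and h: "h \<in> iso G H"
  shows "bij_betw ((`) h) (index_subgroups G n) (index_subgroups H n)"
proof -
  let ?k = "inv_into (carrier G) h"
  have k: "?k \<in> iso H G" using group.iso_set_sym[OF G h] .
  have im: "h ` carrier G = carrier H" and inj: "inj_on h (carrier G)"
    using h by (auto simp: iso_iff)
  have "?k ` h ` \<Delta> = \<Delta>" if "\<Delta> \<in> index_subgroups G n" for \<Delta>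
    using that by (intro inv_into_image_cancel[OF inj]) (auto simp: index_subgroups_def dest: subgroup.subset)
  moreover have "h ` ?k ` \<Delta> = \<Delta>" if "\<Delta> \<in> index_subgroups H n" for \<Delta>
    using that by (intro image_inv_into_cancel[OF im]) (auto simp: index_subgroups_def dest: subgroup.subset)
  moreover have "(`) h ` index_subgroups G n \<subseteq> index_subgroups H n"
    using iso_image_index_subgroups[OF G H h] by blast
  moreover have "(`) ?k ` index_subgroups H n \<subseteq> index_subgroups G n"
    using iso_image_index_subgroups[OF H G k] by blast
  ultimately show ?thesis
    by (intro bij_betw_byWitness[where f' = "(`) ?k"]) auto
qed

lemma iso_image_subgroup_cong:
  assumes G: "group G" and H: "group H" and h: "h \<in> iso G H" and \<Delta>: "subgroup \<Delta> G"
  shows "G\<lparr>carrier := \<Delta>\<rparr> \<cong> K \<longleftrightarrow> H\<lparr>carrier := h ` \<Delta>\<rparr> \<cong> K"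
proof -
  have iso: "G\<lparr>carrier := \<Delta>\<rparr> \<cong> H\<lparr>carrier := h ` \<Delta>\<rparr>"
    using iso_restrict[OF h G H \<Delta>] unfolding is_iso_def by blast
  show ?thesis
    using iso_trans[OF iso] iso_trans[OF group.iso_sym[OF subgroup.subgroup_is_group[OF \<Delta> G] iso]]
    by (intro iffI)
qed

lemma num_subgroups_iso:
  assumes G: "group G" and H: "group H" and h: "h \<in> iso G H"
  shows "num_subgroups K G n = num_subgroups K H n"
proof -
  let ?A = "{\<Delta> \<in> index_subgroups G n. G\<lparr>carrier := \<Delta>\<rparr> \<cong> K}"
  let ?B = "{\<Delta> \<in> index_subgroups H n. H\<lparr>carrier := \<Delta>\<rparr> \<cong> K}"
  have "bij_betw ((`) h) ?A ?B"
  proof (rule bij_betw_subset[OF bij_betw_index_subgroups[OF G H h]])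
    have "((`) h) ` ?A = {\<Delta> \<in> (`) h ` index_subgroups G n. H\<lparr>carrier := \<Delta>\<rparr> \<cong> K}"
      using iso_image_subgroup_cong[OF G H h] by (auto simp: index_subgroups_def)
    then show "((`) h) ` ?A = ?B"
      using bij_betw_index_subgroups[OF G H h, of n] by (simp add: bij_betw_def)
  qed auto
  then show ?thesis unfolding num_subgroups_def by (rule bij_betw_same_card)
qed

section \<open>Values of words\<close>

primrec word_value :: "('g, 'm) monoid_scheme \<Rightarrow> ('a \<Rightarrow> 'g) \<Rightarrow> 'a word \<Rightarrow> 'g" where
  "word_value G h [] = \<one>\<^bsub>G\<^esub>"
| "word_value G h (p # u) =
     (if snd p then h (fst p) else inv\<^bsub>G\<^esub> h (fst p)) \<otimes>\<^bsub>G\<^esub> word_value G h u"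

context group
begin

lemma word_value_closed:
  assumes "\<And>a. h a \<in> carrier G"
  shows "word_value G h u \<in> carrier G"
  using assms by (induction u) auto

lemma word_value_append:
  assumes "\<And>a. h a \<in> carrier G"
  shows "word_value G h (u @ v) = word_value G h u \<otimes> word_value G h v"
  using assms by (induction u) (auto simp: m_assoc word_value_closed)

lemma word_value_word_eq:
  assumes h: "\<And>a. h a \<in> carrier G"
    and R: "\<And>l r. (l, r) \<in> R \<Longrightarrow> word_value G h l = word_value G h r"
    and "word_eq R u v"
  shows "word_value G h u = word_value G h v"
  using assms(3)
proof induction
  case (relation l r)
  then show ?case by (rule R)
qed (simp_all add: word_value_append[OF h] h)

text \<open>
  The relations hold in \<open>G\<close>, so evaluation of words is well defined on the presented group. It is
  injective as soon as some function \<open>nf\<close> picks for each element of \<open>G\<close> a class of words in a way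
  that is compatible with left multiplication by one letter: then, by induction on the word, \<open>nf\<close>
  recovers the class of every word from its value. This avoids proving that \<open>nf\<close> is a homomorphism.
\<close>

lemma presented_group_iso:
  assumes h: "\<And>a. h a \<in> carrier G"
    and R: "\<And>l r. (l, r) \<in> R \<Longrightarrow> word_value G h l = word_value G h r"
    and gen: "carrier G \<subseteq> range (word_value G h)"
    and nf_one: "nf \<one> = word_class R []"
    and nf_step: "\<And>p g. g \<in> carrier G \<Longrightarrow>
      nf (word_value G h [p] \<otimes> g) = word_class R [p] \<otimes>\<^bsub>presented_group R\<^esub> nf g"
  shows "\<exists>f. f \<in> iso (presented_group R) G"
proof -
  have nf: "nf (word_value G h u) = word_class R u" for u
  proof (induction u)
    case (Cons p u)
    have "word_value G h (p # u) = word_value G h [p] \<otimes> word_value G h u"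
      using h by (simp add: word_value_closed)
    then show ?case
      using nf_step[of "word_value G h u" p] word_value_closed[of h u] h Cons
        presented_group_mult[of R "[p]" u]
      by simp
  qed (simp add: nf_one)
  have eq: "word_class R u = word_class R v \<longleftrightarrow> word_value G h u = word_value G h v" for u v
    using word_value_word_eq[OF h R] nf by (metis word_class_eq_iff)
  define f where "f A = word_value G h (SOME u. word_class R u = A)" for A
  have f: "f (word_class R u) = word_value G h u" for u
    unfolding f_def by (metis (mono_tags) eq someI)
  have P: "carrier (presented_group R) = range (word_class R)"
    by (simp add: presented_group_def)
  have "f \<in> iso (presented_group R) G"
    unfolding iso_iff P
  proof (intro conjI)
    show "f \<in> hom (presented_group R) G"
      by (rule homI) (auto simp: P f presented_group_mult word_value_append[OF h] word_value_closed[OF h])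
    show "f ` range (word_class R) = carrier G"
      using gen word_value_closed[OF h] by (auto simp: f image_image)
    show "inj_on f (range (word_class R))"
      by (auto simp: inj_on_def f eq)
  qed
  then show ?thesis by blast
qed

text \<open>
  Conjugation by \<open>w\<close> is a homomorphism and takes \<open>x\<close> to \<open>x'\<close>. The cases of interest are
  \<open>x' = x\<close> (commuting elements) and \<open>x' = x\<^sup>-\<^sup>1\<close> (the action of \<open>z\<close>).
\<close>

lemma intertwine_int_pow:
  assumes "w \<in> carrier G" "x \<in> carrier G" "x' \<in> carrier G" and "w \<otimes> x = x' \<otimes> w"
  shows "w \<otimes> x [^] (k::int) = x' [^] k \<otimes> w"
proof -
  let ?c = "\<lambda>g. w \<otimes> g \<otimes> inv w"
  have x': "?c x = x'" using assms by (simp add: m_assoc)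
  have "?c \<in> hom G G"
  proof (rule homI)
    fix g k assume "g \<in> carrier G" "k \<in> carrier G"
    then show "?c (g \<otimes> k) = ?c g \<otimes> ?c k"
      using assms(1) by (simp add: m_assoc inv_solve_left)
  qed (use assms in simp)
  then have "?c (x [^] k) = ?c x [^] k"
    using hom_int_pow[OF _ assms(2) is_group is_group] by blast
  then show ?thesis using assms x' by (metis int_pow_closed inv_solve_right m_closed)
qed

end

section \<open>The semidirect products of the plane lattice with the integers\<close>

definition parity_sign :: "int \<Rightarrow> int" where
  "parity_sign c = (if even c then 1 else - 1)"

lemma parity_sign_simps [simp]:
  "parity_sign 0 = 1" "parity_sign 1 = - 1"
  "parity_sign (- c) = parity_sign c"
  "parity_sign c * parity_sign c = 1"
  "parity_sign c * (parity_sign c * x) = x"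
  by (simp_all add: parity_sign_def)

lemma parity_sign_add: "parity_sign (c + d) = parity_sign c * parity_sign d"
  by (simp add: parity_sign_def)

lemma parity_sign_diff: "parity_sign (c - d) = parity_sign c * parity_sign d"
  by (simp add: parity_sign_def)

text \<open>
  One family covers both groups of interest: for odd \<open>l\<close> the third coordinate acts on the plane
  through its parity, and for even \<open>l\<close> the action is trivial. The value of \<open>l\<close> will be the third
  pivot of a Hermite normal form, whose parity decides the isomorphism type of the subgroup.
\<close>

definition twisted_group :: "int \<Rightarrow> (int \<times> int \<times> int) monoid" where
  "twisted_group l =
    \<lparr>carrier = UNIV,
     mult = (\<lambda>(x, y, z) (x', y', z').
       (x + parity_sign (l * z) * x', y + parity_sign (l * z) * y', z + z')),
     one = (0, 0, 0)\<rparr>"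

lemma carrier_twisted_group [simp]: "carrier (twisted_group l) = UNIV"
  and one_twisted_group [simp]: "\<one>\<^bsub>twisted_group l\<^esub> = (0, 0, 0)"
  and mult_twisted_group [simp]: "(x, y, z) \<otimes>\<^bsub>twisted_group l\<^esub> (x', y', z') =
    (x + parity_sign (l * z) * x', y + parity_sign (l * z) * y', z + z')"
  by (simp_all add: twisted_group_def)

lemma group_twisted_group: "group (twisted_group l)"
proof (rule groupI)
  fix g h k assume "g \<in> carrier (twisted_group l)"
  show "g \<otimes>\<^bsub>twisted_group l\<^esub> h \<otimes>\<^bsub>twisted_group l\<^esub> k =
      g \<otimes>\<^bsub>twisted_group l\<^esub> (h \<otimes>\<^bsub>twisted_group l\<^esub> k)"
    by (cases g; cases h; cases k) (simp add: parity_sign_add algebra_simps)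
  show "\<exists>h \<in> carrier (twisted_group l). h \<otimes>\<^bsub>twisted_group l\<^esub> g = \<one>\<^bsub>twisted_group l\<^esub>"
  proof (cases g)
    case (fields x y z)
    then show ?thesis
      by (intro bexI[of _ "(- parity_sign (l * z) * x, - parity_sign (l * z) * y, - z)"]) simp_all
  qed
  show "\<one>\<^bsub>twisted_group l\<^esub> \<otimes>\<^bsub>twisted_group l\<^esub> g = g"
    by (cases g) simp
qed simp_all

lemma inv_twisted_group [simp]:
  "inv\<^bsub>twisted_group l\<^esub> (x, y, z) = (- parity_sign (l * z) * x, - parity_sign (l * z) * y, - z)"
  by (rule group.inv_equality[OF group_twisted_group]) simp_all

lemma twisted_group_even: "even l \<Longrightarrow> twisted_group l = Z3"
  by (simp add: twisted_group_def Z3_def DirProd_def integer_group_def parity_sign_def fun_eq_iff)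

lemma twisted_group_odd: "odd l \<Longrightarrow> twisted_group l = twisted_group 1"
  by (simp add: twisted_group_def parity_sign_def)

section \<open>The presentation\<close>

lemma twisted_group_1_generated:
  fixes h :: "gen \<Rightarrow> int \<times> int \<times> int"
  assumes h: "h X = (1, 0, 0)" "h Y = (0, 1, 0)" "h Z = (0, 0, 1)"
  shows "carrier (twisted_group 1) \<subseteq> range (word_value (twisted_group 1) h)"
proof
  fix g :: "int \<times> int \<times> int"
  let ?v = "word_value (twisted_group 1) h"
  define pow where "pow a k = replicate (nat \<bar>k\<bar>) (a, k \<ge> 0)" for a :: gen and k :: int
  have pow: "?v (replicate n (X, b)) = (if b then int n else - int n, 0, 0)"
    "?v (replicate n (Y, b)) = (0, if b then int n else - int n, 0)"
    "?v (replicate n (Z, b)) = (0, 0, if b then int n else - int n)" for n b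
    by (induction n) (auto simp: h)
  obtain x y z where g: "g = (x, y, z)" by (cases g)
  have "g = ?v (pow X x @ pow Y y @ pow Z z)"
    by (simp add: group.word_value_append[OF group_twisted_group] pow_def pow g)
  then show "g \<in> range ?v" by (rule range_eqI)
qed

lemma (in group) inverts_inv:
  assumes "x \<in> carrier G" "z \<in> carrier G" "z \<otimes> x = inv x \<otimes> z"
  shows "inv z \<otimes> x = inv x \<otimes> inv z"
proof -
  have "x \<otimes> z = z \<otimes> inv x"
    using assms by (metis inv_closed inv_solve_left inv_solve_right m_assoc m_closed)
  then show ?thesis
    using assms by (metis inv_closed inv_solve_left inv_solve_right m_assoc m_closed)
qed

text \<open>
  The normal form of \<open>(i, j, k)\<close> is \<open>x\<^sup>i y\<^sup>j z\<^sup>k\<close>. The relations say that \<open>y\<close> commutes with \<open>x\<close> and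
  that \<open>z\<close> inverts \<open>x\<close> and \<open>y\<close>; then \<open>z\<^sup>-\<^sup>1\<close> inverts them too. This is enough to move a letter
  multiplied from the left past the preceding powers to its place.
\<close>

lemma pi1_G2_iso_twisted_group: "\<exists>f. f \<in> iso pi1_G2 (twisted_group 1)"
proof -
  define R where "R = {([(X, True), (Y, True), (X, False), (Y, False)], []),
      ([(Z, True), (X, True), (Z, False)], [(X, False)]),
      ([(Z, True), (Y, True), (Z, False)], [(Y, False)])}"
  have P_def: "pi1_G2 = presented_group R"
    by (simp add: pi1_G2_def R_def Let_def)
  interpret P: group "presented_group R"
    by (rule group_presented_group)
  let ?P = "presented_group R"
  let ?T = "twisted_group 1"
  interpret T: group ?T by (rule group_twisted_group)
  define c where "c a b = word_class R [(a, b)]" for a b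
  define x y z where "x = c X True" and "y = c Y True" and "z = c Z True"
  have c_closed: "c a b \<in> carrier ?P" for a b
    by (simp add: c_def presented_group_def)
  have one: "\<one>\<^bsub>?P\<^esub> = word_class R []"
    by (simp add: presented_group_def)
  have c_inv: "c a False = inv\<^bsub>?P\<^esub> c a True" for a
  proof (rule P.inv_equality[symmetric])
    show "c a False \<otimes>\<^bsub>?P\<^esub> c a True = \<one>\<^bsub>?P\<^esub>"
      using word_eq.cancel[of R a False]
      by (simp add: c_def one presented_group_mult word_class_eq_iff)
  qed (rule c_closed)+
  note closed [simp] = c_closed[of X True, folded x_def] c_closed[of Y True, folded y_def]
    c_closed[of Z True, folded z_def]
  have rel: "word_class R l = word_class R r" if "(l, r) \<in> R" for l r
    using that by (simp add: word_class_eq_iff word_eq.relation)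
  have class_Cons: "word_class R (p # q # u) =
      c (fst p) (snd p) \<otimes>\<^bsub>?P\<^esub> word_class R (q # u)" for p q u
    by (simp add: c_def presented_group_mult)
  have class_single: "word_class R [p] = c (fst p) (snd p)" for p
    by (simp add: c_def)
  have "word_class R [(X, True), (Y, True), (X, False), (Y, False)] = word_class R []"
    by (rule rel) (simp add: R_def)
  then have "(x \<otimes>\<^bsub>?P\<^esub> y) \<otimes>\<^bsub>?P\<^esub> inv\<^bsub>?P\<^esub> (y \<otimes>\<^bsub>?P\<^esub> x) = \<one>\<^bsub>?P\<^esub>"
    by (simp add: class_Cons class_single c_inv one P.inv_mult_group P.m_assoc
        flip: x_def y_def)
  then have yx: "y \<otimes>\<^bsub>?P\<^esub> x = x \<otimes>\<^bsub>?P\<^esub> y"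
    by (simp add: P.inv_solve_right')
  have "word_class R [(Z, True), (X, True), (Z, False)] = word_class R [(X, False)]"
    by (rule rel) (simp add: R_def)
  then have "inv\<^bsub>?P\<^esub> x = (z \<otimes>\<^bsub>?P\<^esub> x) \<otimes>\<^bsub>?P\<^esub> inv\<^bsub>?P\<^esub> z"
    by (simp add: class_Cons class_single c_inv P.m_assoc flip: x_def z_def)
  then have zx: "z \<otimes>\<^bsub>?P\<^esub> x = inv\<^bsub>?P\<^esub> x \<otimes>\<^bsub>?P\<^esub> z"
    by (simp add: P.inv_solve_right)
  have "word_class R [(Z, True), (Y, True), (Z, False)] = word_class R [(Y, False)]"
    by (rule rel) (simp add: R_def)
  then have "inv\<^bsub>?P\<^esub> y = (z \<otimes>\<^bsub>?P\<^esub> y) \<otimes>\<^bsub>?P\<^esub> inv\<^bsub>?P\<^esub> z"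
    by (simp add: class_Cons class_single c_inv P.m_assoc flip: y_def z_def)
  then have zy: "z \<otimes>\<^bsub>?P\<^esub> y = inv\<^bsub>?P\<^esub> y \<otimes>\<^bsub>?P\<^esub> z"
    by (simp add: P.inv_solve_right)
  define e :: "bool \<Rightarrow> int" where "e b = (if b then 1 else - 1)" for b
  have c_pow: "c a b = c a True [^]\<^bsub>?P\<^esub> e b" for a b
    by (cases b) (simp_all add: e_def c_inv c_closed P.int_pow_neg)
  \<comment> \<open>Taking the exponent \<open>e b\<close> treats \<open>z\<close> and its inverse at once.\<close>
  have z_x: "z [^]\<^bsub>?P\<^esub> e b \<otimes>\<^bsub>?P\<^esub> x [^]\<^bsub>?P\<^esub> i = x [^]\<^bsub>?P\<^esub> (- i) \<otimes>\<^bsub>?P\<^esub> z [^]\<^bsub>?P\<^esub> e b" for b and i :: int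
  proof -
    have "z [^]\<^bsub>?P\<^esub> e b \<otimes>\<^bsub>?P\<^esub> x = inv\<^bsub>?P\<^esub> x \<otimes>\<^bsub>?P\<^esub> z [^]\<^bsub>?P\<^esub> e b"
      using zx P.inverts_inv[OF _ _ zx] by (simp add: e_def P.int_pow_neg)
    from P.intertwine_int_pow[OF _ _ _ this, of i] show ?thesis
      by (simp add: P.int_pow_inv P.int_pow_neg)
  qed
  have z_y: "z [^]\<^bsub>?P\<^esub> e b \<otimes>\<^bsub>?P\<^esub> y [^]\<^bsub>?P\<^esub> i = y [^]\<^bsub>?P\<^esub> (- i) \<otimes>\<^bsub>?P\<^esub> z [^]\<^bsub>?P\<^esub> e b" for b and i :: int
  proof -
    have "z [^]\<^bsub>?P\<^esub> e b \<otimes>\<^bsub>?P\<^esub> y = inv\<^bsub>?P\<^esub> y \<otimes>\<^bsub>?P\<^esub> z [^]\<^bsub>?P\<^esub> e b"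
      using zy P.inverts_inv[OF _ _ zy] by (simp add: e_def P.int_pow_neg)
    from P.intertwine_int_pow[OF _ _ _ this, of i] show ?thesis
      by (simp add: P.int_pow_inv P.int_pow_neg)
  qed
  have y_x: "y [^]\<^bsub>?P\<^esub> j \<otimes>\<^bsub>?P\<^esub> x [^]\<^bsub>?P\<^esub> i = x [^]\<^bsub>?P\<^esub> i \<otimes>\<^bsub>?P\<^esub> y [^]\<^bsub>?P\<^esub> j" for i j :: int
  proof -
    have "x [^]\<^bsub>?P\<^esub> i \<otimes>\<^bsub>?P\<^esub> y = y \<otimes>\<^bsub>?P\<^esub> x [^]\<^bsub>?P\<^esub> i"
      using P.intertwine_int_pow[OF _ _ _ yx, of i] by simp
    from P.intertwine_int_pow[OF _ _ _ this, of j] show ?thesis by simp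
  qed
  define nf where "nf = (\<lambda>(i::int, j::int, k::int). x [^]\<^bsub>?P\<^esub> i \<otimes>\<^bsub>?P\<^esub> (y [^]\<^bsub>?P\<^esub> j \<otimes>\<^bsub>?P\<^esub> z [^]\<^bsub>?P\<^esub> k))"
  define h :: "gen \<Rightarrow> int \<times> int \<times> int" where
    "h a = (case a of X \<Rightarrow> (1, 0, 0) | Y \<Rightarrow> (0, 1, 0) | Z \<Rightarrow> (0, 0, 1))" for a
  have h: "h X = (1, 0, 0)" "h Y = (0, 1, 0)" "h Z = (0, 0, 1)"
    by (simp_all add: h_def)
  have step: "nf (word_value ?T h [(a, b)] \<otimes>\<^bsub>?T\<^esub> (i, j, k)) = c a b \<otimes>\<^bsub>?P\<^esub> nf (i, j, k)" for a b i j k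
  proof (cases a)
    case X
    have "word_value ?T h [(a, b)] \<otimes>\<^bsub>?T\<^esub> (i, j, k) = (e b + i, j, k)"
      by (simp add: X h e_def)
    then show ?thesis
      by (simp add: X nf_def c_pow[of X b] P.int_pow_mult P.m_assoc flip: x_def)
  next
    case Y
    have "word_value ?T h [(a, b)] \<otimes>\<^bsub>?T\<^esub> (i, j, k) = (i, e b + j, k)"
      by (simp add: Y h e_def)
    moreover have "y [^]\<^bsub>?P\<^esub> e b \<otimes>\<^bsub>?P\<^esub> nf (i, j, k) =
        (y [^]\<^bsub>?P\<^esub> e b \<otimes>\<^bsub>?P\<^esub> x [^]\<^bsub>?P\<^esub> i) \<otimes>\<^bsub>?P\<^esub> (y [^]\<^bsub>?P\<^esub> j \<otimes>\<^bsub>?P\<^esub> z [^]\<^bsub>?P\<^esub> k)"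
      by (simp add: nf_def P.m_assoc)
    ultimately show ?thesis
      by (simp add: Y c_pow[of Y b] y_x flip: y_def) (simp add: nf_def P.int_pow_mult P.m_assoc)
  next
    case Z
    have "word_value ?T h [(a, b)] \<otimes>\<^bsub>?T\<^esub> (i, j, k) = (- i, - j, e b + k)"
      by (simp add: Z h e_def)
    moreover have "z [^]\<^bsub>?P\<^esub> e b \<otimes>\<^bsub>?P\<^esub> nf (i, j, k) =
        (z [^]\<^bsub>?P\<^esub> e b \<otimes>\<^bsub>?P\<^esub> x [^]\<^bsub>?P\<^esub> i) \<otimes>\<^bsub>?P\<^esub> (y [^]\<^bsub>?P\<^esub> j \<otimes>\<^bsub>?P\<^esub> z [^]\<^bsub>?P\<^esub> k)"
      by (simp add: nf_def P.m_assoc)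
    moreover have "\<dots> = x [^]\<^bsub>?P\<^esub> (- i) \<otimes>\<^bsub>?P\<^esub>
        ((z [^]\<^bsub>?P\<^esub> e b \<otimes>\<^bsub>?P\<^esub> y [^]\<^bsub>?P\<^esub> j) \<otimes>\<^bsub>?P\<^esub> z [^]\<^bsub>?P\<^esub> k)"
      unfolding z_x by (simp add: P.m_assoc)
    moreover have "\<dots> = nf (- i, - j, e b + k)"
      unfolding z_y by (simp add: nf_def P.int_pow_mult P.m_assoc)
    ultimately show ?thesis
      by (simp only: Z c_pow[of Z b] z_def)
  qed
  show ?thesis
    unfolding P_def
  proof (rule T.presented_group_iso)
    show "word_value ?T h l = word_value ?T h r" if "(l, r) \<in> R" for l r
      using that by (auto simp: R_def h)
    show "carrier ?T \<subseteq> range (word_value ?T h)"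
      by (rule twisted_group_1_generated) (rule h)+
    show "nf \<one>\<^bsub>?T\<^esub> = word_class R []"
      by (simp add: nf_def flip: one)
    show "nf (word_value ?T h [t] \<otimes>\<^bsub>?T\<^esub> g) = word_class R [t] \<otimes>\<^bsub>?P\<^esub> nf g" for t g
      using step[of "fst t" "snd t" "fst g" "fst (snd g)" "snd (snd g)"]
      by (simp add: class_single)
  qed simp
qed

section \<open>Subgroups in Hermite normal form\<close>

text \<open>
  With \<open>v = (p, q)\<close>, the \<open>m\<close>-th power of \<open>(v, l)\<close> in the group \<open>twisted_group 1\<close> is
  \<open>(twist l m \<cdot> v, m l)\<close>: if \<open>l\<close> is odd, then \<open>(v, l)\<^sup>2 = (0, 2 l)\<close> and the plane components
  alternate between \<open>0\<close> and \<open>v\<close>. In cohomological terms, \<open>twist l\<close> is the crossed homomorphism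
  with value \<open>1\<close> at \<open>1\<close> (\<open>twist_add\<close>).
\<close>

definition twist :: "int \<Rightarrow> int \<Rightarrow> int" where
  "twist l m = (if even l then m else m mod 2)"

lemma twist_0 [simp]: "twist l 0 = 0" and twist_1 [simp]: "twist l 1 = 1"
  by (simp_all add: twist_def)

lemma twist_add: "twist l (m + n) = twist l m + parity_sign (l * m) * twist l n"
  by (auto simp: twist_def parity_sign_def) presburger+

locale hermite_form =
  fixes a b l s p q :: int
  assumes pos: "a > 0" "b > 0" "l > 0"
begin

text \<open>
  The triple \<open>(i, j, m)\<close> goes to \<open>(a, 0, 0)\<^sup>i (s, b, 0)\<^sup>j (p, q, l)\<^sup>m\<close>, the general element of
  the subgroup generated by these three elements. Parametrising the subgroup in this way gives its
  isomorphism type together with the fact that it is a subgroup.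
\<close>

definition embed :: "int \<times> int \<times> int \<Rightarrow> int \<times> int \<times> int" where
  "embed = (\<lambda>(i, j, m). (i * a + j * s + twist l m * p, j * b + twist l m * q, m * l))"

lemma embed_hom: "embed \<in> hom (twisted_group l) (twisted_group 1)"
  by (rule homI) (auto simp: embed_def twist_add algebra_simps)

lemma inj_embed: "inj embed"
  using pos by (auto simp: inj_on_def embed_def)

lemma subgroup_range_embed: "subgroup (range embed) (twisted_group 1)"
proof -
  interpret group_hom "twisted_group l" "twisted_group 1" embed
    using embed_hom group_twisted_group by (simp add: group_hom_def group_hom_axioms_def)
  show ?thesis using img_is_subgroup by simp
qed

lemma range_embed_iso: "(twisted_group 1)\<lparr>carrier := range embed\<rparr> \<cong> twisted_group l"
proof -
  have "embed \<in> iso (twisted_group l) ((twisted_group 1)\<lparr>carrier := range embed\<rparr>)"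
    using embed_hom inj_embed by (simp add: iso_iff hom_def)
  then show ?thesis using group.iso_sym[OF group_twisted_group] unfolding is_iso_def by blast
qed

text \<open>
  Membership is decided by back substitution from the last coordinate to the first, so that each
  coordinate is subject to a single divisibility condition. Both the index and the uniqueness
  of the normal form are read off from this.
\<close>

lemma in_range_embed_iff:
  "(x, y, z) \<in> range embed \<longleftrightarrow> l dvd z \<and> b dvd y - twist l (z div l) * q \<and>
    a dvd x - twist l (z div l) * p - (y - twist l (z div l) * q) div b * s"
proof
  assume "(x, y, z) \<in> range embed"
  then show "l dvd z \<and> b dvd y - twist l (z div l) * q \<and>
    a dvd x - twist l (z div l) * p - (y - twist l (z div l) * q) div b * s"
    using pos by (auto simp: embed_def)
next
  assume *: "l dvd z \<and> b dvd y - twist l (z div l) * q \<and>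
    a dvd x - twist l (z div l) * p - (y - twist l (z div l) * q) div b * s"
  then obtain m j i where m: "z = m * l" and j: "y - twist l (z div l) * q = j * b"
    and i: "x - twist l (z div l) * p - (y - twist l (z div l) * q) div b * s = i * a"
    by (metis dvd_def mult.commute)
  then have "embed (i, j, m) = (x, y, z)"
    using pos by (simp add: embed_def algebra_simps)
  then show "(x, y, z) \<in> range embed" by (metis rangeI)
qed

lemma line_projection: "(x, 0, 0) \<in> range embed \<longleftrightarrow> a dvd x"
  by (simp add: in_range_embed_iff)

lemma row_projection: "(\<exists>x. (x, y, 0) \<in> range embed) \<longleftrightarrow> b dvd y"
proof
  assume "b dvd y"
  then have "(y div b * s, y, 0) \<in> range embed" by (simp add: in_range_embed_iff)
  then show "\<exists>x. (x, y, 0) \<in> range embed" ..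
qed (auto simp: in_range_embed_iff)

lemma height_projection: "(\<exists>x y. (x, y, z) \<in> range embed) \<longleftrightarrow> l dvd z"
proof
  assume "l dvd z"
  then have "(twist l (z div l) * p, twist l (z div l) * q, z) \<in> range embed"
    by (simp add: in_range_embed_iff)
  then show "\<exists>x y. (x, y, z) \<in> range embed" by blast
qed (auto simp: in_range_embed_iff)

end

lemma ex1_residue:
  fixes d x e :: int
  assumes "d > 0" and e: "e * e = 1"
  shows "\<exists>!r. r \<in> {0..<d} \<and> d dvd x - e * r"
proof (rule ex1I)
  have "x - e * (e * x mod d) = e * (e * x - e * x mod d)"
    using e by (simp add: algebra_simps flip: mult.assoc)
  then show "e * x mod d \<in> {0..<d} \<and> d dvd x - e * (e * x mod d)"
    using assms(1) by (simp add: minus_mod_eq_mult_div)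
next
  fix r assume r: "r \<in> {0..<d} \<and> d dvd x - e * r"
  then have "d dvd e * (x - e * r)" by simp
  moreover have "e * (x - e * r) = e * x - r"
    using e by (simp add: algebra_simps flip: mult.assoc)
  ultimately have "d dvd e * x - r" by simp
  then have "e * x mod d = r mod d" by (simp add: mod_eq_dvd_iff)
  then show "r = e * x mod d" using r by simp
qed

text \<open>
  The box of reduced vectors is a transversal of the right cosets: the third coordinate \<open>w\<close> of the
  representative is fixed modulo \<open>l\<close>, which fixes the sign \<open>e\<close>, after which the second coordinate is
  fixed modulo \<open>b\<close> and finally the first modulo \<open>a\<close>.
\<close>

lemma (in hermite_form) range_embed_in_index_subgroups:
  "range embed \<in> index_subgroups (twisted_group 1) (nat a * nat b * nat l)"
proof -
  interpret T: group "twisted_group 1" by (rule group_twisted_group)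
  let ?B = "{0..<a} \<times> {0..<b} \<times> {0..<l}"
  have "card (rcosets\<^bsub>twisted_group 1\<^esub> (range embed)) = card ?B"
  proof (rule T.card_rcosets_eq_card_transversal[OF subgroup_range_embed])
    fix g :: "int \<times> int \<times> int"
    obtain x y z where g: "g = (x, y, z)" by (cases g)
    have diff: "g \<otimes>\<^bsub>twisted_group 1\<^esub> inv\<^bsub>twisted_group 1\<^esub> (u, v, w) =
        (x - parity_sign (z - w) * u, y - parity_sign (z - w) * v, z - w)" for u v w
      by (simp add: g parity_sign_diff)
    obtain w where w: "w \<in> {0..<l}" "l dvd z - w"
      and w_unique: "\<And>w'. w' \<in> {0..<l} \<Longrightarrow> l dvd z - w' \<Longrightarrow> w' = w"
      using ex1_residue[OF pos(3), of 1 z] by auto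
    define e f where "e = parity_sign (z - w)" and "f = twist l ((z - w) div l)"
    have e: "e * e = 1" by (simp add: e_def)
    obtain v where v: "v \<in> {0..<b}" "b dvd (y - f * q) - e * v"
      and v_unique: "\<And>v'. v' \<in> {0..<b} \<Longrightarrow> b dvd (y - f * q) - e * v' \<Longrightarrow> v' = v"
      using ex1_residue[OF pos(2) e, of "y - f * q"] by blast
    define j where "j = (y - e * v - f * q) div b"
    obtain u where u: "u \<in> {0..<a}" "a dvd (x - f * p - j * s) - e * u"
      and u_unique: "\<And>u'. u' \<in> {0..<a} \<Longrightarrow> a dvd (x - f * p - j * s) - e * u' \<Longrightarrow> u' = u"
      using ex1_residue[OF pos(1) e, of "x - f * p - j * s"] by blast
    show "\<exists>!t. t \<in> ?B \<and> g \<otimes>\<^bsub>twisted_group 1\<^esub> inv\<^bsub>twisted_group 1\<^esub> t \<in> range embed"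
    proof (rule ex1I[of _ "(u, v, w)"])
      show "(u, v, w) \<in> ?B \<and>
          g \<otimes>\<^bsub>twisted_group 1\<^esub> inv\<^bsub>twisted_group 1\<^esub> (u, v, w) \<in> range embed"
        using u v w unfolding diff in_range_embed_iff
        by (simp flip: e_def f_def add: j_def algebra_simps)
    next
      fix t assume t: "t \<in> ?B \<and> g \<otimes>\<^bsub>twisted_group 1\<^esub> inv\<^bsub>twisted_group 1\<^esub> t \<in> range embed"
      obtain u' v' w' where t_eq: "t = (u', v', w')" by (cases t)
      have "w' = w"
        using t w_unique unfolding t_eq diff in_range_embed_iff by simp
      moreover from this have "v' = v"
        using t v_unique unfolding t_eq diff in_range_embed_iff
        by (simp flip: e_def f_def add: algebra_simps)
      moreover from calculation have "u' = u"
        using t u_unique unfolding t_eq diff in_range_embed_iff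
        by (simp flip: e_def f_def add: j_def algebra_simps)
      ultimately show "t = (u, v, w)" by (simp add: t_eq)
    qed
  qed simp
  also have "card ?B = nat a * nat b * nat l" by simp
  finally show ?thesis using subgroup_range_embed by (simp add: index_subgroups_def)
qed

text \<open>
  The pivots \<open>a\<close>, \<open>b\<close>, \<open>l\<close> generate, respectively, the intersection of \<open>\<Delta>\<close> with the first axis, the
  second coordinates of its intersection with the plane, and its third coordinates. Elements
  of \<open>\<Delta>\<close> over the pivots are reduced by the earlier generators, and any element of \<open>\<Delta>\<close> is cleared
  coordinate by coordinate, starting with the last.
\<close>

lemma finite_index_subgroup_hermite:
  assumes \<Delta>: "\<Delta> \<in> index_subgroups (twisted_group 1) n" and n: "n > 0"
  shows "\<exists>a b l s p q. a > 0 \<and> b > 0 \<and> l > 0 \<and> s \<in> {0..<a} \<and> p \<in> {0..<a} \<and> q \<in> {0..<b} \<and>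
    \<Delta> = range (hermite_form.embed a b l s p q)"
proof -
  let ?T = "twisted_group 1"
  interpret T: group ?T by (rule group_twisted_group)
  have sub: "subgroup \<Delta> ?T" and fin: "finite (rcosets\<^bsub>?T\<^esub> \<Delta>)"
    using \<Delta> n card.infinite by (fastforce simp: index_subgroups_def)+
  have closed: "(x + parity_sign z * x', y + parity_sign z * y', z + z') \<in> \<Delta>"
    if "(x, y, z) \<in> \<Delta>" "(x', y', z') \<in> \<Delta>" for x y z x' y' z'
    using subgroup.m_closed[OF sub that] by simp
  have diff: "(x - parity_sign (z - z') * x', y - parity_sign (z - z') * y', z - z') \<in> \<Delta>"
    if "(x, y, z) \<in> \<Delta>" "(x', y', z') \<in> \<Delta>" for x y z x' y' z'
    using subgroup.m_closed[OF sub that(1) subgroup.m_inv_closed[OF sub that(2)]]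
    by (simp add: parity_sign_diff mult.assoc)
  have "\<exists>a>0. {x. (x, 0, 0) \<in> \<Delta>} = {x. a dvd x}"
  proof (rule int_diff_closed_principal)
    show "\<exists>k>0. k \<in> {x. (x, 0, 0) \<in> \<Delta>}"
      using T.finite_index_meets_int_hom[OF sub fin, of "\<lambda>k. (k, 0, 0)"] by (simp add: hom_def)
  qed (use diff[of _ 0 0 _ 0 0] in simp)
  then obtain a where a: "a > 0" "\<And>x. (x, 0, 0) \<in> \<Delta> \<longleftrightarrow> a dvd x" by blast
  have "\<exists>b>0. {y. \<exists>x. (x, y, 0) \<in> \<Delta>} = {y. b dvd y}"
  proof (rule int_diff_closed_principal)
    show "\<exists>k>0. k \<in> {y. \<exists>x. (x, y, 0) \<in> \<Delta>}"
      using T.finite_index_meets_int_hom[OF sub fin, of "\<lambda>k. (0, k, 0)"] by (auto simp: hom_def)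
  qed (use diff[of _ _ 0 _ _ 0] in fastforce)
  then obtain b where b: "b > 0" "\<And>y. (\<exists>x. (x, y, 0) \<in> \<Delta>) \<longleftrightarrow> b dvd y" by blast
  have "\<exists>l>0. {z. \<exists>x y. (x, y, z) \<in> \<Delta>} = {z. l dvd z}"
  proof (rule int_diff_closed_principal)
    show "\<exists>k>0. k \<in> {z. \<exists>x y. (x, y, z) \<in> \<Delta>}"
      using T.finite_index_meets_int_hom[OF sub fin, of "\<lambda>k. (0, 0, k)"] by (auto simp: hom_def)
  qed (use diff in blast)
  then obtain l where l: "l > 0" "\<And>z. (\<exists>x y. (x, y, z) \<in> \<Delta>) \<longleftrightarrow> l dvd z" by blast
  have reduce: "(x mod a, y, z) \<in> \<Delta>" if "(x, y, z) \<in> \<Delta>" for x y z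
    using closed[of "- (x div a * a)" 0 0 x y z] that a(2)[of "- (x div a * a)"]
    by (simp add: minus_div_mult_eq_mod)
  obtain s0 where "(s0, b, 0) \<in> \<Delta>" using b(2)[of b] by auto
  then obtain s where s: "s \<in> {0..<a}" "(s, b, 0) \<in> \<Delta>"
    using reduce[of s0 b 0] a(1) that[of "s0 mod a"] by simp
  have sb: "(j * s, j * b, 0) \<in> \<Delta>" for j
    using T.int_hom_in_subgroup[OF sub, of "\<lambda>j. (j * s, j * b, 0)" j] s(2)
    by (simp add: hom_def algebra_simps)
  obtain p0 q0 where pq0: "(p0, q0, l) \<in> \<Delta>" using l(2)[of l] by auto
  then have "(p0 - q0 div b * s, q0 mod b, l) \<in> \<Delta>"
    using closed[OF sb[of "- (q0 div b)"] pq0] by (simp add: minus_div_mult_eq_mod)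
  then obtain p q where pq: "p \<in> {0..<a}" "q \<in> {0..<b}" "(p, q, l) \<in> \<Delta>"
    using reduce[of "p0 - q0 div b * s" "q0 mod b" l] a(1) b(1)
      that[of "(p0 - q0 div b * s) mod a" "q0 mod b"] by simp
  interpret hermite_form a b l s p q by unfold_locales (use a b l in auto)
  have pql: "(twist l m * p, twist l m * q, m * l) \<in> \<Delta>" for m
  proof -
    have "(\<lambda>m. (twist l m * p, twist l m * q, m * l)) \<in> hom integer_group ?T"
      by (rule homI) (simp_all add: twist_add algebra_simps)
    from T.int_hom_in_subgroup[OF sub this, of m] show ?thesis using pq(3) by simp
  qed
  have "embed (i, j, m) \<in> \<Delta>" for i j m
    using closed[of "i * a" 0 0, OF _ closed[OF sb[of j] pql[of m]]] a(2)[of "i * a"]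
    by (simp add: embed_def algebra_simps)
  moreover have "(x, y, z) \<in> range embed" if xyz: "(x, y, z) \<in> \<Delta>" for x y z
  proof -
    have "l dvd z" using l(2)[of z] xyz by blast
    then obtain m where m: "z = m * l" by (metis dvdE mult.commute)
    have 1: "(x - twist l m * p, y - twist l m * q, 0) \<in> \<Delta>"
      using diff[OF xyz pql[of m]] m by simp
    then have "b dvd y - twist l m * q" using b(2) by blast
    then obtain j where j: "y - twist l m * q = j * b" by (metis dvdE mult.commute)
    have "(x - twist l m * p - j * s, 0, 0) \<in> \<Delta>"
      using diff[OF 1 sb[of j]] j by simp
    then have "a dvd x - twist l m * p - j * s" using a(2) by blast
    then obtain i where i: "x - twist l m * p - j * s = i * a" by (metis dvdE mult.commute)
    have "embed (i, j, m) = (x, y, z)"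
      using m i j by (simp add: embed_def algebra_simps)
    then show ?thesis by (metis rangeI)
  qed
  ultimately have "\<Delta> = range embed" by auto
  then show ?thesis using a(1) b(1) l(1) s(1) pq(1,2) by blast
qed

text \<open>
  The projections determine the pivots. Two generators over the same pivot differ by an element of
  the span of the earlier generators, and they agree because both are reduced.
\<close>

lemma hermite_form_unique:
  assumes H: "hermite_form a b l" "hermite_form a' b' l'"
    and red: "s \<in> {0..<a}" "p \<in> {0..<a}" "q \<in> {0..<b}" "s' \<in> {0..<a'}" "p' \<in> {0..<a'}" "q' \<in> {0..<b'}"
    and eq: "range (hermite_form.embed a b l s p q) = range (hermite_form.embed a' b' l' s' p' q')"
  shows "a = a' \<and> b = b' \<and> l = l' \<and> s = s' \<and> p = p' \<and> q = q'"
proof -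
  interpret A: hermite_form a b l s p q by fact
  interpret B: hermite_form a' b' l' s' p' q' by fact
  note pos = A.pos B.pos
  have dvd_eq: "d = d'" if "d > 0" "d' > 0" "\<And>k. d dvd k \<longleftrightarrow> d' dvd k" for d d' :: int
    using that by (metis dvd_refl zdvd_antisym_nonneg less_imp_le)
  have small: "r = r'" if "d dvd r - r'" "r \<in> {0..<d}" "r' \<in> {0..<d}" for d r r' :: int
    using that by (metis atLeastLessThan_iff mod_eq_dvd_iff mod_pos_pos_trivial)
  have a: "a = a'"
    using pos by (intro dvd_eq) (simp_all add: eq flip: A.line_projection B.line_projection)
  have b: "b = b'"
    using pos by (intro dvd_eq) (simp_all add: eq flip: A.row_projection B.row_projection)
  have l: "l = l'"
    using pos by (intro dvd_eq) (simp_all add: eq flip: A.height_projection B.height_projection)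
  have "A.embed (0, 1, 0) = (s, b, 0)" "A.embed (0, 0, 1) = (p, q, l)"
    by (simp_all add: A.embed_def)
  then have mem: "(s, b, 0) \<in> range B.embed" "(p, q, l) \<in> range B.embed"
    using eq by (metis rangeI)+
  then have "a dvd s - s'"
    using pos unfolding B.in_range_embed_iff by (simp add: a b)
  then have s: "s = s'" using small red a by blast
  have pq: "b dvd q - q'" "a dvd p - p' - (q - q') div b * s'"
    using mem(2) pos unfolding B.in_range_embed_iff by (simp_all add: a b l)
  then have q: "q = q'" using small red b by blast
  then have "p = p'" using pq small red a by simp
  then show ?thesis using a b l s q by simp
qed

section \<open>Counting\<close>

text \<open>
  The first component \<open>k\<close> is the index \<open>a b\<close> of the plane lattice, so that the components are
  \<open>(a b, a, s, p, q)\<close>. The set \<open>K\<close> of admissible \<open>k\<close> is a parameter in order to count the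
  subgroups of each isomorphism type separately.
\<close>

definition hermite_params :: "nat set \<Rightarrow> (nat \<times> nat \<times> nat \<times> nat \<times> nat) set" where
  "hermite_params K = (SIGMA k:K. SIGMA a:{a. a dvd k}. {0..<a} \<times> {0..<a} \<times> {0..<k div a})"

text \<open>
  With \<open>k\<close> and a divisor \<open>a\<close> fixed, there are \<open>a\<close> choices of \<open>s\<close>, \<open>a\<close> of \<open>p\<close> and \<open>k / a\<close> of \<open>q\<close>, which
  makes \<open>k a\<close> in all.
\<close>

lemma card_hermite_params:
  assumes "finite K" and "\<And>k. k \<in> K \<Longrightarrow> k > 0"
  shows "card (hermite_params K) = (\<Sum>k\<in>K. k * sigma1 k)"
proof -
  have "card (SIGMA a:{a. a dvd k}. {0..<a} \<times> {0..<a} \<times> {0..<k div a}) = k * sigma1 k"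
    if "k \<in> K" for k
  proof -
    have "card (SIGMA a:{a. a dvd k}. {0..<a} \<times> {0..<a} \<times> {0..<k div a}) =
        (\<Sum>a | a dvd k. a * (a * (k div a)))"
      using assms(2)[OF that] by (subst card_SigmaI) (auto simp: finite_divisors_nat)
    also have "\<dots> = (\<Sum>a | a dvd k. k * a)"
      by (intro sum.cong) auto
    finally show ?thesis by (simp add: sigma1_def sum_distrib_left)
  qed
  then show ?thesis
    unfolding hermite_params_def using assms
    by (subst card_SigmaI) (auto simp: finite_divisors_nat intro!: finite_SigmaI)
qed

definition hermite_subgroup ::
  "nat \<Rightarrow> nat \<times> nat \<times> nat \<times> nat \<times> nat \<Rightarrow> (int \<times> int \<times> int) set" where
  "hermite_subgroup n = (\<lambda>(k, a, s, p, q).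
    range (hermite_form.embed (int a) (int (k div a)) (int (n div k)) (int s) (int p) (int q)))"

lemma hermite_form_params:
  assumes "n > 0" "k dvd n" "a dvd k"
  shows "hermite_form (int a) (int (k div a)) (int (n div k))"
proof -
  have "k > 0" using assms dvd_pos_nat by blast
  then have "a > 0" using assms dvd_pos_nat by blast
  then show ?thesis
    using assms \<open>k > 0\<close> by unfold_locales (simp_all add: div_greater_zero_iff dvd_imp_le)
qed

lemma bij_betw_hermite_subgroup:
  assumes n: "n > 0"
  shows "bij_betw (hermite_subgroup n) (hermite_params {k. k dvd n})
    (index_subgroups (twisted_group 1) n)"
  unfolding bij_betw_def
proof
  let ?P = "hermite_params {k. k dvd n}"
  show "inj_on (hermite_subgroup n) ?P"
  proof (rule inj_onI)
    fix t t' assume t: "t \<in> ?P" and t': "t' \<in> ?P" and eq: "hermite_subgroup n t = hermite_subgroup n t'"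
    obtain k a s p q where t_eq: "t = (k, a, s, p, q)" by (cases t)
    obtain k' a' s' p' q' where t'_eq: "t' = (k', a', s', p', q')" by (cases t')
    have dvd: "k dvd n" "a dvd k" "k' dvd n" "a' dvd k'"
      using t t' by (auto simp: t_eq t'_eq hermite_params_def)
    have "int a = int a' \<and> int (k div a) = int (k' div a') \<and> int (n div k) = int (n div k') \<and>
        int s = int s' \<and> int p = int p' \<and> int q = int q'"
    proof (rule hermite_form_unique)
      show "hermite_form (int a) (int (k div a)) (int (n div k))"
        "hermite_form (int a') (int (k' div a')) (int (n div k'))"
        by (rule hermite_form_params[OF n] dvd)+
    qed (use t t' eq in \<open>simp_all add: t_eq t'_eq hermite_params_def hermite_subgroup_def flip: of_nat_div\<close>)
    then have a: "a = a'" and b: "k div a = k' div a'" and "s = s'" "p = p'" "q = q'"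
      unfolding of_nat_eq_iff by blast+
    moreover have "k = k'"
    proof -
      have "k = a * (k div a)" using dvd(2) by (rule dvd_mult_div_cancel[symmetric])
      also have "\<dots> = a' * (k' div a')" unfolding b unfolding a ..
      also have "\<dots> = k'" using dvd(4) by (rule dvd_mult_div_cancel)
      finally show ?thesis .
    qed
    ultimately show "t = t'" by (simp add: t_eq t'_eq)
  qed
  show "hermite_subgroup n ` ?P = index_subgroups (twisted_group 1) n"
  proof (intro equalityI subsetI)
    fix \<Delta> assume "\<Delta> \<in> hermite_subgroup n ` ?P"
    then obtain k a s p q where dvd: "k dvd n" "a dvd k"
      and \<Delta>: "\<Delta> = hermite_subgroup n (k, a, s, p, q)"
      by (auto simp: hermite_params_def)
    have "a * (k div a) * (n div k) = n" using dvd by simp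
    then show "\<Delta> \<in> index_subgroups (twisted_group 1) n"
      using hermite_form.range_embed_in_index_subgroups[OF hermite_form_params[OF n dvd], of s p q]
      unfolding \<Delta> hermite_subgroup_def prod.case nat_int by (simp only:)
  next
    fix \<Delta> assume \<Delta>: "\<Delta> \<in> index_subgroups (twisted_group 1) n"
    from finite_index_subgroup_hermite[OF \<Delta> n]
    obtain a b l s p q where pos: "a > 0" "b > 0" "l > 0"
      and red: "s \<in> {0..<a}" "p \<in> {0..<a}" "q \<in> {0..<b}"
      and eq: "\<Delta> = range (hermite_form.embed a b l s p q)"
      by blast
    interpret hermite_form a b l s p q by unfold_locales (rule pos)+
    have n_eq: "n = nat a * nat b * nat l"
      using \<Delta> range_embed_in_index_subgroups by (simp add: eq index_subgroups_def)
    define t where "t = (nat a * nat b, nat a, nat s, nat p, nat q)"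
    \<comment> \<open>Dividing by \<open>k = a b\<close> and by \<open>a\<close> recovers the pivots \<open>l\<close> and \<open>b\<close>.\<close>
    have quot: "nat a * nat b div nat a = nat b" "n div (nat a * nat b) = nat l"
      using pos by (simp_all add: n_eq)
    have "nat a * nat b dvd n" by (simp add: n_eq)
    then have "t \<in> ?P"
      using red by (simp add: t_def hermite_params_def quot(1))
    moreover have "hermite_subgroup n t = \<Delta>"
      unfolding t_def hermite_subgroup_def prod.case quot eq using red pos by simp
    ultimately show "\<Delta> \<in> hermite_subgroup n ` ?P" by blast
  qed
qed

lemma hermite_subgroup_iso:
  assumes "n > 0" "k dvd n" "a dvd k"
  shows "(twisted_group 1)\<lparr>carrier := hermite_subgroup n (k, a, s, p, q)\<rparr> \<cong>
    (if even (n div k) then Z3 else twisted_group 1)"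
proof -
  interpret hermite_form "int a" "int (k div a)" "int (n div k)" "int s" "int p" "int q"
    by (rule hermite_form_params) (rule assms)+
  show ?thesis
    using range_embed_iso twisted_group_even[of "int (n div k)"] twisted_group_odd[of "int (n div k)"]
    by (auto simp: hermite_subgroup_def simp flip: of_nat_div)
qed

text \<open>
  The elements \<open>x\<close> and \<open>z\<close> do not commute.
\<close>

lemma twisted_group_1_not_iso_Z3: "\<not> twisted_group 1 \<cong> Z3"
proof
  assume "twisted_group 1 \<cong> Z3"
  then obtain f where f: "f \<in> iso (twisted_group 1) (twisted_group 0)"
    using twisted_group_even[of 0] by (auto simp: is_iso_def)
  have comm: "g \<otimes>\<^bsub>twisted_group 0\<^esub> h = h \<otimes>\<^bsub>twisted_group 0\<^esub> g" for g h
    by (cases g; cases h) simp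
  let ?x = "(1, 0, 0) :: int \<times> int \<times> int" and ?z = "(0, 0, 1) :: int \<times> int \<times> int"
  have "f (?x \<otimes>\<^bsub>twisted_group 1\<^esub> ?z) = f (?z \<otimes>\<^bsub>twisted_group 1\<^esub> ?x)"
    using comm[of "f ?x" "f ?z"] hom_mult[OF iso_imp_homomorphism[OF f]]
    by (simp only: carrier_twisted_group UNIV_I)
  then have "?x \<otimes>\<^bsub>twisted_group 1\<^esub> ?z = ?z \<otimes>\<^bsub>twisted_group 1\<^esub> ?x"
    using f by (simp only: iso_iff carrier_twisted_group) (metis injD)
  then show False by simp
qed

text \<open>
  The isomorphism type of a subgroup depends on its parameters only through \<open>k\<close>; the predicate \<open>Q\<close>
  singles out the values of \<open>k\<close> for which this type is \<open>H\<close>.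
\<close>

lemma num_subgroups_twisted_group:
  assumes n: "n > 0"
    and K: "\<And>k. k dvd n \<Longrightarrow> (if even (n div k) then Z3 else twisted_group 1) \<cong> H \<longleftrightarrow> Q k"
  shows "num_subgroups H (twisted_group 1) n = (\<Sum>k | k dvd n \<and> Q k. k * sigma1 k)"
proof -
  let ?T = "twisted_group 1"
  let ?A = "{\<Delta> \<in> index_subgroups ?T n. ?T\<lparr>carrier := \<Delta>\<rparr> \<cong> H}"
  note bij = bij_betw_hermite_subgroup[OF n]
  have iff: "?T\<lparr>carrier := hermite_subgroup n (k, a, s, p, q)\<rparr> \<cong> H \<longleftrightarrow> Q k"
    if "k dvd n" "a dvd k" for k a s p q
  proof -
    have iso: "?T\<lparr>carrier := hermite_subgroup n (k, a, s, p, q)\<rparr> \<cong>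
        (if even (n div k) then Z3 else ?T)" (is "?D \<cong> ?S")
      by (rule hermite_subgroup_iso[OF n that])
    interpret hermite_form "int a" "int (k div a)" "int (n div k)" "int s" "int p" "int q"
      by (rule hermite_form_params[OF n that])
    have "group ?D"
      using subgroup.subgroup_is_group[OF subgroup_range_embed group_twisted_group]
      by (simp add: hermite_subgroup_def flip: of_nat_div)
    then have "?S \<cong> ?D" using iso by (rule group.iso_sym)
    then have "?D \<cong> H \<longleftrightarrow> ?S \<cong> H" using iso iso_trans[of ?S ?D H] iso_trans[of ?D ?S H] by satx
    then show ?thesis using K[OF that(1)] by simp
  qed
  have "hermite_subgroup n ` hermite_params {k. k dvd n \<and> Q k} = ?A"
  proof (intro equalityI subsetI)
    fix \<Delta> assume "\<Delta> \<in> hermite_subgroup n ` hermite_params {k. k dvd n \<and> Q k}"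
    then obtain t where t: "t \<in> hermite_params {k. k dvd n \<and> Q k}" "\<Delta> = hermite_subgroup n t"
      by blast
    moreover from t have "\<Delta> \<in> index_subgroups ?T n"
      using bij by (auto simp: bij_betw_def hermite_params_def)
    ultimately show "\<Delta> \<in> ?A" using iff by (auto simp: hermite_params_def)
  next
    fix \<Delta> assume \<Delta>: "\<Delta> \<in> ?A"
    then have "\<Delta> \<in> hermite_subgroup n ` hermite_params {k. k dvd n}"
      using bij by (simp add: bij_betw_def)
    then obtain t where t: "t \<in> hermite_params {k. k dvd n}" "\<Delta> = hermite_subgroup n t"
      by blast
    then have "t \<in> hermite_params {k. k dvd n \<and> Q k}"
      using \<Delta> iff by (auto simp: hermite_params_def)
    then show "\<Delta> \<in> hermite_subgroup n ` hermite_params {k. k dvd n \<and> Q k}" using t by blast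
  qed
  moreover have "inj_on (hermite_subgroup n) (hermite_params {k. k dvd n \<and> Q k})"
    using bij unfolding bij_betw_def by (auto intro: inj_on_subset simp: hermite_params_def)
  ultimately have "num_subgroups H ?T n = card (hermite_params {k. k dvd n \<and> Q k})"
    unfolding num_subgroups_def by (simp flip: card_image)
  also have "\<dots> = (\<Sum>k | k dvd n \<and> Q k. k * sigma1 k)"
    using n by (intro card_hermite_params) (auto simp: dvd_pos_nat)
  finally show ?thesis .
qed

lemma num_subgroups_target_iso:
  assumes "group K" "K \<cong> K'"
  shows "num_subgroups K G n = num_subgroups K' G n"
proof -
  have "G\<lparr>carrier := \<Delta>\<rparr> \<cong> K \<longleftrightarrow> G\<lparr>carrier := \<Delta>\<rparr> \<cong> K'" for \<Delta>
    using iso_trans[OF _ assms(2)] iso_trans[OF _ group.iso_sym[OF assms]] by (intro iffI)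
  then show ?thesis by (simp add: num_subgroups_def)
qed

lemma omega_of_nat: "n > 0 \<Longrightarrow> omega (of_nat n) = (\<Sum>k | k dvd n. k * sigma1 k)"
  by (simp add: omega_def)

lemma omega_half:
  assumes "n > 0"
  shows "omega (of_nat n / 2) = (\<Sum>k | k dvd n \<and> even (n div k). k * sigma1 k)"
proof (cases "even n")
  case True
  then obtain m where m: "n = 2 * m" by blast
  have "k dvd n \<and> even (n div k) \<longleftrightarrow> k dvd m" for k
  proof
    assume k: "k dvd n \<and> even (n div k)"
    then obtain c where "n div k = 2 * c" by blast
    then have "n = k * (2 * c)" using dvd_mult_div_cancel[of k n] k by simp
    then show "k dvd m" by (simp add: m)
  next
    assume "k dvd m"
    then obtain c where "m = k * c" by blast
    then show "k dvd n \<and> even (n div k)" using assms by (simp add: m)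
  qed
  then show ?thesis using omega_of_nat[of m] assms by (simp add: m)
next
  case False
  have "(of_nat n / 2 :: rat) \<notin> \<int>"
  proof
    assume "(of_nat n / 2 :: rat) \<in> \<int>"
    then obtain z where "(of_nat n / 2 :: rat) = of_int z" by (auto elim: Ints_cases)
    then have "of_int (int n) = (of_int (2 * z) :: rat)" by simp
    then have "int n = 2 * z" by (simp only: of_int_eq_iff)
    then show False using False by presburger
  qed
  moreover have none: "{k. k dvd n \<and> even (n div k)} = {}"
  proof -
    have "odd (n div k)" if "k dvd n" for k
      using False dvd_mult_div_cancel[OF that] even_mult_iff[of k "n div k"] by simp
    then show ?thesis by blast
  qed
  ultimately show ?thesis unfolding none by (simp add: omega_def)
qed

theorem theorem1:
  fixes n :: nat
  assumes "n > 0"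
  shows "(\<forall>\<Delta> \<in> index_subgroups pi1_G2 n.
            pi1_G2\<lparr>carrier := \<Delta>\<rparr> \<cong> pi1_G2 \<or> pi1_G2\<lparr>carrier := \<Delta>\<rparr> \<cong> Z3)
       \<and> finite (index_subgroups pi1_G2 n)
       \<and> int (num_subgroups pi1_G2 pi1_G2 n) = int (omega (of_nat n)) - int (omega (of_nat n / 2))
       \<and> num_subgroups Z3 pi1_G2 n = omega (of_nat n / 2)"
proof -
  let ?T = "twisted_group 1"
  obtain f where f: "f \<in> iso pi1_G2 ?T" using pi1_G2_iso_twisted_group by blast
  have G: "group pi1_G2" by (simp add: pi1_G2_def group_presented_group Let_def)
  have T: "group ?T" by (rule group_twisted_group)
  have GT: "pi1_G2 \<cong> ?T" using f by (auto simp: is_iso_def)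
  have TG: "?T \<cong> pi1_G2" using group.iso_sym[OF G GT] .
  note bij = bij_betw_index_subgroups[OF G T f, of n]
  note herm = bij_betw_hermite_subgroup[OF assms]
  have cases: "pi1_G2\<lparr>carrier := \<Delta>\<rparr> \<cong> pi1_G2 \<or> pi1_G2\<lparr>carrier := \<Delta>\<rparr> \<cong> Z3"
    if \<Delta>: "\<Delta> \<in> index_subgroups pi1_G2 n" for \<Delta>
  proof -
    have "f ` \<Delta> \<in> hermite_subgroup n ` hermite_params {k. k dvd n}"
      unfolding bij_betw_imp_surj_on[OF herm] bij_betw_imp_surj_on[OF bij, symmetric]
      using \<Delta> by (rule imageI)
    then obtain t where t: "f ` \<Delta> = hermite_subgroup n t" "t \<in> hermite_params {k. k dvd n}"
      by (rule imageE)
    moreover obtain k a s p q where "t = (k, a, s, p, q)" by (cases t)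
    ultimately have iso: "?T\<lparr>carrier := f ` \<Delta>\<rparr> \<cong> (if even (n div k) then Z3 else ?T)"
      using hermite_subgroup_iso[OF assms] by (simp add: hermite_params_def)
    have "?T\<lparr>carrier := f ` \<Delta>\<rparr> \<cong> Z3 \<or> ?T\<lparr>carrier := f ` \<Delta>\<rparr> \<cong> pi1_G2"
    proof (cases "even (n div k)")
      case True
      then show ?thesis using iso by simp
    next
      case False
      then have "?T\<lparr>carrier := f ` \<Delta>\<rparr> \<cong> ?T" using iso by simp
      then have "?T\<lparr>carrier := f ` \<Delta>\<rparr> \<cong> pi1_G2" using TG by (rule iso_trans)
      then show ?thesis ..
    qed
    moreover have sub: "subgroup \<Delta> pi1_G2" using \<Delta> by (simp add: index_subgroups_def)
    ultimately show ?thesis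
      using iso_image_subgroup_cong[OF G T f sub, of Z3]
        iso_image_subgroup_cong[OF G T f sub, of pi1_G2]
      by satx
  qed
  have finite: "finite (index_subgroups pi1_G2 n)"
  proof -
    have "finite {a. a dvd k}" if "k dvd n" for k
      using finite_divisors_nat[OF dvd_pos_nat[OF assms that]] .
    then have "finite (hermite_params {k. k dvd n})"
      unfolding hermite_params_def using finite_divisors_nat[OF assms]
      by (intro finite_SigmaI finite_cartesian_product finite_atLeastLessThan) simp_all
    then show ?thesis using bij_betw_finite[OF bij] bij_betw_finite[OF herm] by simp
  qed
  have Z3: "num_subgroups Z3 pi1_G2 n = omega (of_nat n / 2)"
  proof -
    have "(if even (n div k) then Z3 else ?T) \<cong> Z3 \<longleftrightarrow> even (n div k)" for k
      using twisted_group_1_not_iso_Z3 by (simp add: iso_refl)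
    from num_subgroups_twisted_group[OF assms this] show ?thesis
      unfolding num_subgroups_iso[OF G T f] omega_half[OF assms] .
  qed
  have odd: "num_subgroups pi1_G2 pi1_G2 n = (\<Sum>k | k dvd n \<and> odd (n div k). k * sigma1 k)"
  proof -
    have "group Z3"
      using group_twisted_group[of 0] twisted_group_even[of 0] by simp
    then have "\<not> Z3 \<cong> ?T"
      using twisted_group_1_not_iso_Z3 group.iso_sym[of Z3 ?T] by satx
    then have "(if even (n div k) then Z3 else ?T) \<cong> ?T \<longleftrightarrow> odd (n div k)" for k
      by (simp add: iso_refl)
    from num_subgroups_twisted_group[OF assms this] show ?thesis
      unfolding num_subgroups_iso[OF G T f] num_subgroups_target_iso[OF G GT] .
  qed
  have omega: "omega (of_nat n) = (\<Sum>k | k dvd n \<and> odd (n div k). k * sigma1 k) + omega (of_nat n / 2)"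
  proof -
    have "omega (of_nat n) =
        (\<Sum>k\<in>{k. k dvd n \<and> odd (n div k)} \<union> {k. k dvd n \<and> even (n div k)}. k * sigma1 k)"
      unfolding omega_of_nat[OF assms] by (intro sum.cong) auto
    also have "\<dots> = (\<Sum>k | k dvd n \<and> odd (n div k). k * sigma1 k) + omega (of_nat n / 2)"
      unfolding omega_half[OF assms] using assms
      by (intro sum.union_disjoint) auto
    finally show ?thesis .
  qed
  have "int (num_subgroups pi1_G2 pi1_G2 n) = int (omega (of_nat n)) - int (omega (of_nat n / 2))"
    unfolding odd omega by simp
  then show ?thesis
    by (intro conjI ballI cases finite Z3)
qed

end
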